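(* Let $I$ be a set, let $R \subseteq I^2$ be a relation, and let $R^w\subseteq(\beta I)^2$ be its weak extension. Then: (i) if $R$ is reflexive then $R^{w}$ is reflexive; (ii) if $R$ is symmetric then $R^{w}$ is symmetric; (iii) if $R$ is transitive then $R^{w}$ is transitive; (iv) if $R$ is connected then $R^{w}$ is connected. In particular, if $R$ is an equivalence relation, then $R^{w}$ is an equivalence relation, and if $R$ is a total pre-order then $R^{w}$ is a total pre-order.
   Context: $\beta I$ denotes the set of all ultrafilters on $I$. The weak extension $R^w\subseteq(\beta I)^2$ of $R\subseteq I^2$ is defined by: $R^w(u,v)$ holds iff for all $A\in u$ and all $B\in v$ there exist $a\in A$ and $b\in B$ such that $R(a,b)$. A relation $S\subseteq X^2$ is connected when for all $x\neq y$ in $X$, $S(x,y)$ or $S(y,x)$ holds. A pre-order is a reflexive and transitive relation; a total pre-order is a connected pre-order. *)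

theory Defs
  imports Main
begin

(* HOL filters live on a whole type; a filter on the carrier set I is one below principal I,
   and "A belongs to u" is rendered as "eventually (\<lambda>x. x \<in> A) u". *)

definition ultrafilter :: "'a filter \<Rightarrow> bool" where
  "ultrafilter u \<longleftrightarrow> u \<noteq> bot \<and> (\<forall>P. eventually P u \<or> eventually (\<lambda>x. \<not> P x) u)"

definition ultrafilters_on :: "'a set \<Rightarrow> 'a filter set" where
  "ultrafilters_on I = {u. ultrafilter u \<and> u \<le> principal I}"

definition weak_extension :: "'a set \<Rightarrow> 'a rel \<Rightarrow> 'a filter rel" where
  "weak_extension I R =
     {(u, v) \<in> ultrafilters_on I \<times> ultrafilters_on I.
        \<forall>A B. A \<subseteq> I \<and> B \<subseteq> I \<and> eventually (\<lambda>x. x \<in> A) u \<and> eventually (\<lambda>x. x \<in> B) v \<longrightarrow>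
          (\<exists>a\<in>A. \<exists>b\<in>B. (a, b) \<in> R)}"

(* In the order on filters, finer means smaller, so maximal proper filters are minimal here. *)
lemma ultrafilter_iff_maximal:
  "ultrafilter u \<longleftrightarrow> u \<noteq> bot \<and> (\<forall>w. w \<noteq> bot \<longrightarrow> w \<le> u \<longrightarrow> w = u)"
proof (intro iffI conjI allI impI)
  assume u: "ultrafilter u"
  then show "u \<noteq> bot" by (simp add: ultrafilter_def)
  fix w assume w: "w \<noteq> bot" "w \<le> u"
  have "u \<le> w"
  proof (rule filter_leI)
    fix P assume P: "eventually P w"
    show "eventually P u"
    proof (rule ccontr)
      assume "\<not> eventually P u"
      then have "eventually (\<lambda>x. \<not> P x) u" using u by (auto simp: ultrafilter_def)
      then have "eventually (\<lambda>x. \<not> P x) w" using w(2) by (rule filter_leD[rotated])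
      with P have "eventually (\<lambda>x. False) w" by eventually_elim simp
      with w(1) show False by (simp add: trivial_limit_def)
    qed
  qed
  with w(2) show "w = u" by (rule antisym)
next
  assume u: "u \<noteq> bot \<and> (\<forall>w. w \<noteq> bot \<longrightarrow> w \<le> u \<longrightarrow> w = u)"
  show "ultrafilter u" unfolding ultrafilter_def
  proof (intro conjI allI)
    show "u \<noteq> bot" using u by simp
    fix P
    let ?w = "inf u (principal {x. P x})"
    show "eventually P u \<or> eventually (\<lambda>x. \<not> P x) u"
    proof (cases "?w = bot")
      case True
      then show ?thesis by (simp add: trivial_limit_def eventually_inf_principal)
    next
      case False
      then have "?w = u" using u by simp
      moreover have "eventually P ?w" by (simp add: eventually_inf_principal)
      ultimately show ?thesis by simp
    qed
  qed
qed

end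

theory Submission
  imports Defs
begin

text \<open>Reflexivity and symmetry are immediate: two members of one ultrafilter meet inside
  \<open>I\<close>, and the defining condition is symmetric up to swapping the two filters. For
  transitivity, the \<open>R\<close>-image of a member of \<open>u\<close> must belong to the middle
  ultrafilter \<open>v\<close>, as otherwise its complement would belong to \<open>v\<close> and
  contradict that \<open>u\<close> is related to \<open>v\<close>; so this image can be tested
  against members of \<open>w\<close>. For connectedness, failure in both directions yields large
  sets with no \<open>R\<close>-pairs between them either way; a set separating \<open>u\<close>
  from \<open>v\<close> then provides two distinct points of \<open>I\<close> that \<open>R\<close>
  does not compare.\<close>

lemma ultrafilters_on_ex:
  assumes "u \<in> ultrafilters_on I" "eventually P u"
  shows "\<exists>x\<in>I. P x"
proof -
  have "u \<noteq> bot" "eventually (\<lambda>x. x \<in> I) u"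
    using assms by (auto simp: ultrafilters_on_def ultrafilter_def le_principal)
  with assms(2) have "\<exists>\<^sub>F x in u. x \<in> I \<and> P x"
    by (intro eventually_frequently eventually_conj)
  then show ?thesis by (auto dest: frequently_ex)
qed

lemma ultrafilters_on_not_eventually:
  assumes "u \<in> ultrafilters_on I" "\<not> eventually P u"
  shows "eventually (\<lambda>x. \<not> P x) u"
  using assms by (auto simp: ultrafilters_on_def ultrafilter_def)

text \<open>Since \<open>I\<close> belongs to both ultrafilters, arbitrary predicates can be cut
  down to subsets of \<open>I\<close> and remain large. This lets the later proofs combine
  predicates without tracking inclusions in \<open>I\<close>.\<close>

lemma mem_weak_extension_iff:
  "(u, v) \<in> weak_extension I R \<longleftrightarrow> u \<in> ultrafilters_on I \<and> v \<in> ultrafilters_on I \<and>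
     (\<forall>P Q. eventually P u \<longrightarrow> eventually Q v \<longrightarrow> (\<exists>a\<in>I. \<exists>b\<in>I. P a \<and> Q b \<and> (a, b) \<in> R))"
  (is "?L \<longleftrightarrow> ?R")
proof
  assume L: ?L
  then have uv: "u \<in> ultrafilters_on I" "v \<in> ultrafilters_on I"
    by (auto simp: weak_extension_def)
  then have I: "eventually (\<lambda>x. x \<in> I) u" "eventually (\<lambda>x. x \<in> I) v"
    by (auto simp: ultrafilters_on_def le_principal)
  have "\<exists>a\<in>I. \<exists>b\<in>I. P a \<and> Q b \<and> (a, b) \<in> R" if "eventually P u" "eventually Q v" for P Q
  proof -
    have "eventually (\<lambda>x. x \<in> {a \<in> I. P a}) u" "eventually (\<lambda>x. x \<in> {b \<in> I. Q b}) v"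
      using that I by (simp_all add: eventually_conj)
    moreover have "{a \<in> I. P a} \<subseteq> I" "{b \<in> I. Q b} \<subseteq> I" by auto
    ultimately have "\<exists>a\<in>{a \<in> I. P a}. \<exists>b\<in>{b \<in> I. Q b}. (a, b) \<in> R"
      using L unfolding weak_extension_def by blast
    then show ?thesis by blast
  qed
  with uv show ?R by blast
next
  assume ?R
  then show ?L unfolding weak_extension_def by fast
qed

lemma refl_on_weak_extension:
  assumes "refl_on I R"
  shows "refl_on (ultrafilters_on I) (weak_extension I R)"
proof (rule refl_onI)
  fix u assume u: "u \<in> ultrafilters_on I"
  have "\<exists>a\<in>I. \<exists>b\<in>I. P a \<and> Q b \<and> (a, b) \<in> R" if "eventually P u" "eventually Q u" for P Q
    using ultrafilters_on_ex[OF u eventually_conj[OF that]] assms by (auto dest: refl_onD)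
  with u show "(u, u) \<in> weak_extension I R" by (auto simp: mem_weak_extension_iff)
qed

text \<open>The conclusion is the unrestricted \<open>sym\<close>, the form that
  \<open>equiv\<close> demands; the relativized form follows by restriction. The same holds for
  \<open>trans\<close> below.\<close>

lemma sym_weak_extension:
  assumes "sym_on I R"
  shows "sym (weak_extension I R)"
proof (rule symI)
  fix u v assume "(u, v) \<in> weak_extension I R"
  then show "(v, u) \<in> weak_extension I R"
    unfolding mem_weak_extension_iff using sym_onD[OF assms] by meson
qed

lemma trans_weak_extension:
  assumes "trans_on I R"
  shows "trans (weak_extension I R)"
proof (rule transI)
  fix u v w
  assume uv: "(u, v) \<in> weak_extension I R" and vw: "(v, w) \<in> weak_extension I R"
  have "\<exists>a\<in>I. \<exists>c\<in>I. P a \<and> Q c \<and> (a, c) \<in> R" if P: "eventually P u" and Q: "eventually Q w" for P Q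
  proof -
    \<comment> \<open>This is the image of \<open>P\<close> under \<open>R\<close>. If it were not
      large for \<open>v\<close>, its complement would be, and \<open>P\<close> would have no
      \<open>R\<close>-edge into that complement.\<close>
    have "eventually (\<lambda>b. \<exists>a\<in>I. P a \<and> (a, b) \<in> R) v"
    proof (rule ccontr)
      assume "\<not> ?thesis"
      with uv have "eventually (\<lambda>b. \<not> (\<exists>a\<in>I. P a \<and> (a, b) \<in> R)) v"
        by (intro ultrafilters_on_not_eventually) (auto simp: mem_weak_extension_iff)
      with uv P show False unfolding mem_weak_extension_iff by blast
    qed
    with vw Q have "\<exists>b\<in>I. \<exists>c\<in>I. (\<exists>a\<in>I. P a \<and> (a, b) \<in> R) \<and> Q c \<and> (b, c) \<in> R"
      unfolding mem_weak_extension_iff by simp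
    then show ?thesis using assms by (blast dest: trans_onD)
  qed
  with uv vw show "(u, w) \<in> weak_extension I R" by (auto simp: mem_weak_extension_iff)
qed

lemma total_on_weak_extension:
  assumes "total_on I R"
  shows "total_on (ultrafilters_on I) (weak_extension I R)"
proof (rule total_onI, rule ccontr)
  fix u v
  assume u: "u \<in> ultrafilters_on I" and v: "v \<in> ultrafilters_on I" and "u \<noteq> v"
    and *: "\<not> ((u, v) \<in> weak_extension I R \<or> (v, u) \<in> weak_extension I R)"
  \<comment> \<open>An ultrafilter is minimal among proper filters, so \<open>v \<le> u\<close>
    would force \<open>v = u\<close>.\<close>
  have "\<not> v \<le> u"
    using u v \<open>u \<noteq> v\<close> by (auto simp: ultrafilters_on_def ultrafilter_iff_maximal)
  then obtain E where E: "eventually E u" "\<not> eventually E v"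
    by (auto simp: le_filter_def)
  \<comment> \<open>One pair of predicates for each failing direction, both listed with the
    predicate for \<open>u\<close> first so that they can be intersected.\<close>
  obtain P Q where PQ: "eventually P u" "eventually Q v"
    "\<And>a b. a \<in> I \<Longrightarrow> b \<in> I \<Longrightarrow> P a \<Longrightarrow> Q b \<Longrightarrow> (a, b) \<notin> R"
    using * u v unfolding mem_weak_extension_iff by blast
  obtain P' Q' where PQ': "eventually P' u" "eventually Q' v"
    "\<And>a b. a \<in> I \<Longrightarrow> b \<in> I \<Longrightarrow> P' a \<Longrightarrow> Q' b \<Longrightarrow> (b, a) \<notin> R"
    using * u v unfolding mem_weak_extension_iff by blast
  \<comment> \<open>Taking \<open>a\<close> inside \<open>E\<close> and \<open>b\<close> outside it
    makes them distinct, so connectedness of \<open>R\<close> applies.\<close>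
  obtain a where a: "a \<in> I" "E a" "P a" "P' a"
    using ultrafilters_on_ex[OF u eventually_conj[OF E(1) eventually_conj[OF PQ(1) PQ'(1)]]] by blast
  obtain b where b: "b \<in> I" "\<not> E b" "Q b" "Q' b"
    using ultrafilters_on_ex[OF v eventually_conj[OF ultrafilters_on_not_eventually[OF v E(2)]
        eventually_conj[OF PQ(2) PQ'(2)]]] by blast
  have "a \<noteq> b" using a b by auto
  with assms a b have "(a, b) \<in> R \<or> (b, a) \<in> R" by (auto simp: total_on_def)
  with a b PQ(3) PQ'(3) show False by blast
qed

theorem theorem3p6:
  fixes I :: "'a set" and R :: "'a rel"
  assumes "R \<subseteq> I \<times> I"
  shows "(refl_on I R \<longrightarrow> refl_on (ultrafilters_on I) (weak_extension I R)) \<and>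
    (sym_on I R \<longrightarrow> sym_on (ultrafilters_on I) (weak_extension I R)) \<and>
    (trans_on I R \<longrightarrow> trans_on (ultrafilters_on I) (weak_extension I R)) \<and>
    (total_on I R \<longrightarrow> total_on (ultrafilters_on I) (weak_extension I R)) \<and>
    (equiv I R \<longrightarrow> equiv (ultrafilters_on I) (weak_extension I R)) \<and>
    (preorder_on I R \<and> total_on I R \<longrightarrow> preorder_on (ultrafilters_on I) (weak_extension I R) \<and> total_on (ultrafilters_on I) (weak_extension I R))"
proof -
  \<comment> \<open>Both \<open>equiv\<close> and \<open>preorder_on\<close> include containment in
    the square of the carrier.\<close>
  have "weak_extension I R \<subseteq> ultrafilters_on I \<times> ultrafilters_on I"
    by (auto simp: weak_extension_def)
  then show ?thesis
    using refl_on_weak_extension[of I R] sym_weak_extension[of I R] trans_weak_extension[of I R]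
      total_on_weak_extension[of I R]
      sym_on_subset[of UNIV "weak_extension I R" "ultrafilters_on I"]
      trans_on_subset[of UNIV "weak_extension I R" "ultrafilters_on I"]
      sym_on_subset[of UNIV R I] trans_on_subset[of UNIV R I]
    unfolding equiv_def preorder_on_def by blast
qed

end
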